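(* Consider the setting described in the context (an asymptotically stable, strictly proper, completely observable and reachable discrete-time SISO LTI system of order $n$ with bounded input and bounded additive output disturbance, a model order $o\ge n$, and data sets satisfying the informative-content assumption). Then, for the quantities $\lambda_p$ and $\underline{\lambda}_p$ defined in the context: 1) $\lambda_p \to \bar d_0-\bar d$ as $p\to\infty$; 2) $\underline{\lambda}_p\le \lambda_p$; 3) for every $\eta\in(0,\lambda_p]$ there exists $N<\infty$ such that $\underline{\lambda}_p\ge \lambda_p-\eta$.
   Context: System: $x(k+1)=Ax(k)+Bu(k)$, $z(k)=Cx(k)$, with $x(k)\in\mathbb{R}^n$, $u(k),z(k)\in\mathbb{R}$, $k\in\mathbb{Z}$; the system is asymptotically stable, strictly proper, completely observable and reachable. The measured output is $y(k)=z(k)+d(k)$ with $|d(k)|\le \bar d_0$ for all $k$, and $u(k)\in\mathbb{U}$ for all $k$, where $\mathbb{U}\subset\mathbb{R}$ is compact. For $p\in\mathbb{N}$, there is a parameter vector $\theta_p^0=[\theta_{p,z}^{0\,T}\ \theta_{p,u}^{0\,T}]^T$ with $z(k+p)=\psi_p(k)^T\theta_p^0$, where $\psi_p(k)=[Z_n(k)^T\ U_{p,n}(k)^T]^T$, $Z_n(k)=[z(k),z(k-1),\dots,z(k-n+1)]^T$, $U_{p,n}(k)=[u(k+p-1),u(k+p-2),\dots,u(k-n+1)]^T$. Model order: $o\in\mathbb{N}$ with $o\ge n$. Model regressor $\varphi_p(k)=[Y_o(k)^T\ U_{p,o}(k)^T]^T\in\mathbb{R}^{2o+p-1}$, with $Y_o(k)=[y(k),\dots,y(k-o+1)]^T$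 and $U_{p,o}(k)=[u(k+p-1),\dots,u(k-o+1)]^T$. Let $\psi_{p,o}(k)=[Z_o(k)^T\ U_{p,o}(k)^T]^T$, which lies in a compact set $\Psi_{p,o}$ for all $k$. Let $\mathbb{D}_p=\{[d^{(1)},\dots,d^{(o)},0,\dots,0]^T\in\mathbb{R}^{2o+p-1}:|d^{(i)}|\le\bar d_0\}$ and $\Phi_p=\Psi_{p,o}\oplus\mathbb{D}_p$ (Minkowski sum). Let $\mathscr{V}_p=\{[\varphi_p^T\ y_p]^T: y_p\in Y_p(\varphi_p),\ \varphi_p\in\Phi_p\}$, where $Y_p(\varphi_p)\subset\mathbb{R}$ is the compact set of all possible measured output values $y(k+p)$ corresponding to regressor value $\varphi_p$ and every disturbance realization $|d|\le\bar d_0$. Data: $N$ measured samples $\tilde{\mathscr{V}}_p^N=\{[\tilde\varphi_p(i)^T\ \tilde y_p(i)]^T,\ i=1,\dots,N\}$, with $\tilde y_p(i)=\tilde y(i+p)$, assumed to satisfy: for every $\beta>0$ there is $N<\infty$ with $\max_{v_1\in\mathscr{V}_p}\min_{v_2\in\tilde{\mathscr{V}}_p^N}\|v_2-v_1\|_2\le\beta$. Let $\bar d\ge 0$ be a chosen disturbance-bound estimate, and let $\Omega\subset\mathbb{R}^{2o+p-1}$ be a compact set (e.g. a large box) approximating the whole parameter space. Define $\lambda_p=\min_{\theta_p\in\Omega}\max_{[\varphi_p^T\ y_p]^T\in\mathscr{V}_p}\big(|y_p-\varphi_p^T\theta_p|-\bar d\big)$, and $\underline{\lambda}_p$ as the optimal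 value of the linear program $\min_{\theta_p,\lambda\ge 0}\lambda$ subject to $|\tilde y_p-\tilde\varphi_p^T\theta_p|\le\lambda+\bar d$ for all $[\tilde\varphi_p^T\ \tilde y_p]^T\in\tilde{\mathscr{V}}_p^N$. Convention: when $o\ne n$, parameter vectors $\theta_p$ or $\theta_p^0$ are padded with zero entries so that their dimensions agree in all products.
   Formalization: Part 2) $\underline{\lambda}_p\le \lambda_p$ holds only when $\lambda_p\ge 0$, and $\Omega$ approximating the whole parameter space means that the minimum over $\Omega$ of the max in $\lambda_p$ equals its infimum over all of $\mathbb{R}^{2o+p-1}$. Each condition added here is assumed in the paper as well or is needed for the statement above to hold. *)

theory Defs
  imports "HOL-Analysis.Analysis"
begin

text \<open>State-space system x(k+1) = A x(k) + B u(k), z(k) = C x(k), state dimension n = CARD('n).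
  Vectors of varying dimension (regressors, parameter vectors) are real lists.\<close>

definition asympt_stable :: "real^'n^'n \<Rightarrow> bool" where
  "asympt_stable A \<longleftrightarrow> (\<forall>x0. (\<lambda>k. (((*v) A) ^^ k) x0) \<longlonglongrightarrow> 0)"

definition completely_observable :: "real^'n^'n \<Rightarrow> real^'n \<Rightarrow> bool" where
  "completely_observable A C \<longleftrightarrow> (\<forall>x0. (\<forall>k. C \<bullet> ((((*v) A) ^^ k) x0) = 0) \<longrightarrow> x0 = 0)"

definition reachable :: "real^'n^'n \<Rightarrow> real^'n \<Rightarrow> bool" where
  "reachable A B \<longleftrightarrow> (\<forall>x. \<exists>N (w::nat \<Rightarrow> real). x = (\<Sum>j<N. w j *\<^sub>R ((((*v) A) ^^ (N - 1 - j)) B)))"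

text \<open>Admissible trajectories on the integer time axis (bounded state, inputs in U,
  output disturbance bounded by d0).\<close>
definition traj :: "real^'n^'n \<Rightarrow> real^'n \<Rightarrow> real set \<Rightarrow> real
     \<Rightarrow> (int \<Rightarrow> real^'n) \<Rightarrow> (int \<Rightarrow> real) \<Rightarrow> (int \<Rightarrow> real) \<Rightarrow> bool" where
  "traj A B U d0 x u d \<longleftrightarrow>
     (\<forall>k. x (k + 1) = A *v x k + u k *\<^sub>R B) \<and> (\<forall>k. u k \<in> U) \<and> (\<forall>k. \<bar>d k\<bar> \<le> d0)
     \<and> bounded (range x)"

text \<open>Z_o(k) (noise free outputs), Y_o(k) (measured outputs), U_{p,m}(k).\<close>
definition Zvec :: "nat \<Rightarrow> (int \<Rightarrow> real) \<Rightarrow> int \<Rightarrow> real list" where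
  "Zvec m z k = map (\<lambda>i. z (k - int i)) [0..<m]"

definition Uvec :: "nat \<Rightarrow> nat \<Rightarrow> (int \<Rightarrow> real) \<Rightarrow> int \<Rightarrow> real list" where
  "Uvec p m u k = map (\<lambda>i. u (k + int p - 1 - int i)) [0..<p + m - 1]"

definition ip :: "real list \<Rightarrow> real list \<Rightarrow> real" where
  "ip a b = (\<Sum>i<length a. a ! i * b ! i)"

text \<open>\<Psi>_{p,m}: set of all values of psi_{p,m}(k).\<close>
definition Psi_set :: "real^'n^'n \<Rightarrow> real^'n \<Rightarrow> real^'n \<Rightarrow> real set \<Rightarrow> real \<Rightarrow> nat \<Rightarrow> nat \<Rightarrow> real list set" where
  "Psi_set A B C U d0 m p =
     {Zvec m (\<lambda>j. C \<bullet> x j) k @ Uvec p m u k | x u d k. traj A B U d0 x u d}"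

definition D_set :: "real \<Rightarrow> nat \<Rightarrow> nat \<Rightarrow> real list set" where
  "D_set d0 m p = {ds @ replicate (p + m - 1) 0 | ds. length ds = m \<and> (\<forall>i<m. \<bar>ds ! i\<bar> \<le> d0)}"

definition Phi_set :: "real^'n^'n \<Rightarrow> real^'n \<Rightarrow> real^'n \<Rightarrow> real set \<Rightarrow> real \<Rightarrow> nat \<Rightarrow> nat \<Rightarrow> real list set" where
  "Phi_set A B C U d0 m p =
     {map2 (+) a b | a b. a \<in> Psi_set A B C U d0 m p \<and> b \<in> D_set d0 m p}"

text \<open>Y_p(phi): all measured outputs y(k+p) for which the measured regressor phi_p(k) equals phi.\<close>
definition Y_set :: "real^'n^'n \<Rightarrow> real^'n \<Rightarrow> real^'n \<Rightarrow> real set \<Rightarrow> real \<Rightarrow> nat \<Rightarrow> nat \<Rightarrow> real list \<Rightarrow> real set" where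
  "Y_set A B C U d0 m p \<phi> =
     {C \<bullet> x (k + int p) + d (k + int p) | x u d k. traj A B U d0 x u d \<and>
        Zvec m (\<lambda>j. C \<bullet> x j + d j) k @ Uvec p m u k = \<phi>}"

definition V_set :: "real^'n^'n \<Rightarrow> real^'n \<Rightarrow> real^'n \<Rightarrow> real set \<Rightarrow> real \<Rightarrow> nat \<Rightarrow> nat \<Rightarrow> (real list \<times> real) set" where
  "V_set A B C U d0 m p =
     {(\<phi>, y). \<phi> \<in> Phi_set A B C U d0 m p \<and> y \<in> Y_set A B C U d0 m p \<phi>}"

text \<open>Euclidean distance between two points [phi; y] of equal dimension.\<close>
definition vdist :: "real list \<times> real \<Rightarrow> real list \<times> real \<Rightarrow> real" where
  "vdist v w = sqrt ((\<Sum>i<length (fst v). (fst v ! i - fst w ! i)\<^sup>2) + (snd v - snd w)\<^sup>2)"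

text \<open>Worst-case cost of theta over a set of data points.\<close>
definition cost :: "(real list \<times> real) set \<Rightarrow> real \<Rightarrow> real list \<Rightarrow> real" where
  "cost V dbar \<theta> = (SUP v\<in>V. \<bar>snd v - ip (fst v) \<theta>\<bar> - dbar)"

definition lambda_p :: "real^'n^'n \<Rightarrow> real^'n \<Rightarrow> real^'n \<Rightarrow> real set \<Rightarrow> real \<Rightarrow> real \<Rightarrow> nat
     \<Rightarrow> (nat \<Rightarrow> real list set) \<Rightarrow> nat \<Rightarrow> real" where
  "lambda_p A B C U d0 dbar m \<Omega> p = (INF \<theta>\<in>\<Omega> p. cost (V_set A B C U d0 m p) dbar \<theta>)"

text \<open>Optimal value of the linear program on the first N samples.\<close>
definition lambda_low :: "real \<Rightarrow> nat \<Rightarrow> (nat \<Rightarrow> nat \<Rightarrow> real list \<times> real) \<Rightarrow> nat \<Rightarrow> nat \<Rightarrow> real" where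
  "lambda_low dbar m data p N =
     Inf {lam. lam \<ge> 0 \<and> (\<exists>\<theta>. length \<theta> = 2 * m + p - 1 \<and>
        (\<forall>i\<in>{1..N}. \<bar>snd (data p i) - ip (fst (data p i)) \<theta>\<bar> \<le> lam + dbar))}"

text \<open>Zero-padding embedding of a list into nat => real (used to state compactness of Omega).\<close>
definition list_emb :: "real list \<Rightarrow> nat \<Rightarrow> real" where
  "list_emb xs = (\<lambda>i. if i < length xs then xs ! i else 0)"

end

theory Submission
  imports Defs
begin

text \<open>
  For every parameter the worst-case cost over the data set is at least d0 - dbar: the regressor
  at time k does not see the disturbance d(k + p), which may take either sign. Conversely the
  parameter that puts zero weight on past outputs and the Markov parameters C A^i B on the inputs
  leaves the prediction error C A^(p+m-1) x(k-m+1) + d(k+p), whose first term tends to zero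
  uniformly by stability and boundedness of the state. This gives the limit of \<lambda>_p.

  The linear program sees only finitely many points of the data set, so its value is at most
  \<lambda>_p. For the converse, a parameter fitting the first N samples can be replaced by one with the
  same predictions on all samples and with entries bounded in terms of the fit on finitely many of
  them: modulo the common kernel of the regressors, the seminorm \<Sum>i<N. |\<langle>\<phi>_i, \<theta>\<rangle>| is a norm
  for N large, by a compactness argument. Since the samples are \<beta>-dense in the data set, this
  bounded parameter has worst-case cost within O(\<beta>) of its fit on the samples.
\<close>

section \<open>Bounded representatives modulo finitely many linear functionals\<close>

text \<open>The dimension 2m + p - 1 of the parameter space varies with p, so parameters are also
  viewed as functions \<^typ>\<open>nat \<Rightarrow> real\<close> vanishing from some L on; this type carries the
  product topology, in which closed bounded sets of such functions are compact.\<close>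

definition ip_fun :: "real list \<Rightarrow> (nat \<Rightarrow> real) \<Rightarrow> real" where
  "ip_fun \<phi> g = (\<Sum>j<length \<phi>. \<phi> ! j * g j)"

definition supported_below :: "nat \<Rightarrow> (nat \<Rightarrow> real) set" where
  "supported_below L = {g. \<forall>x\<ge>L. g x = 0}"

definition norm1_below :: "nat \<Rightarrow> (nat \<Rightarrow> real) \<Rightarrow> real" where
  "norm1_below L g = (\<Sum>x<L. \<bar>g x\<bar>)"

definition abs_ip_sum :: "(nat \<Rightarrow> real list) \<Rightarrow> nat \<Rightarrow> (nat \<Rightarrow> real) \<Rightarrow> real" where
  "abs_ip_sum \<phi> N g = (\<Sum>i<N. \<bar>ip_fun (\<phi> i) g\<bar>)"

definition annihilator :: "nat \<Rightarrow> (nat \<Rightarrow> real list) \<Rightarrow> (nat \<Rightarrow> real) set" where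
  "annihilator L \<phi> = {k \<in> supported_below L. \<forall>i. ip_fun (\<phi> i) k = 0}"

definition min_norm_reps :: "nat \<Rightarrow> (nat \<Rightarrow> real list) \<Rightarrow> (nat \<Rightarrow> real) set" where
  "min_norm_reps L \<phi> = {g \<in> supported_below L.
     \<forall>k\<in>annihilator L \<phi>. norm1_below L g \<le> norm1_below L (\<lambda>x. g x + k x)}"

lemma ip_eq_ip_fun: "ip \<phi> \<theta> = ip_fun \<phi> ((!) \<theta>)"
  by (simp add: ip_def ip_fun_def)

lemma ip_fun_add: "ip_fun \<phi> (\<lambda>x. g x + h x) = ip_fun \<phi> g + ip_fun \<phi> h"
  by (simp add: ip_fun_def distrib_left sum.distrib)

lemma ip_fun_scale: "ip_fun \<phi> (\<lambda>x. c * g x) = c * ip_fun \<phi> g"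
  by (simp add: ip_fun_def sum_distrib_left algebra_simps)

lemma norm1_below_scale: "norm1_below L (\<lambda>x. c * g x) = \<bar>c\<bar> * norm1_below L g"
  by (simp add: norm1_below_def abs_mult sum_distrib_left)

lemma abs_ip_sum_scale: "abs_ip_sum \<phi> N (\<lambda>x. c * g x) = \<bar>c\<bar> * abs_ip_sum \<phi> N g"
  by (simp add: abs_ip_sum_def ip_fun_scale abs_mult sum_distrib_left)

lemma abs_le_norm1_below:
  assumes "g \<in> supported_below L"
  shows "\<bar>g x\<bar> \<le> norm1_below L g"
proof (cases "x < L")
  case True
  then show ?thesis unfolding norm1_below_def by (intro member_le_sum) auto
next
  case False
  then show ?thesis using assms by (simp add: supported_below_def norm1_below_def sum_nonneg)
qed

lemma continuous_on_coordinate [continuous_intros]: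
  "continuous_on S (\<lambda>g::'a \<Rightarrow> 'b::topological_space. g x)"
  by (rule continuous_on_subset[OF continuous_on_product_coordinates subset_UNIV])

lemma continuous_on_ip_fun [continuous_intros]: "continuous_on S (ip_fun \<phi>)"
  unfolding ip_fun_def by (intro continuous_intros)

lemma continuous_on_norm1_below [continuous_intros]: "continuous_on S (norm1_below L)"
  unfolding norm1_below_def by (intro continuous_intros)

lemma continuous_on_abs_ip_sum [continuous_intros]: "continuous_on S (abs_ip_sum \<phi> N)"
  unfolding abs_ip_sum_def by (intro continuous_intros)

lemma closed_supported_below: "closed (supported_below L)"
proof -
  have "supported_below L = (\<Inter>x\<in>{L..}. {g. g x = 0})"
    by (auto simp: supported_below_def)
  then show ?thesis by (auto intro!: closed_INT closed_Collect_eq continuous_intros)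
qed

lemma compact_norm1_below_le: "compact (supported_below L \<inter> {g. norm1_below L g \<le> r})"
proof -
  define box where "box = Pi\<^sub>E UNIV (\<lambda>x. if x < L then cball 0 r else {0::real})"
  have "compactin (product_topology (\<lambda>_. euclidean) UNIV) box"
    unfolding box_def compactin_PiE by auto
  then have "compact box" by (simp add: euclidean_product_topology)
  moreover have "supported_below L \<inter> {g. norm1_below L g \<le> r} = box \<inter> {g. norm1_below L g \<le> r}"
  proof (intro equalityI subsetI)
    fix g assume g: "g \<in> supported_below L \<inter> {g. norm1_below L g \<le> r}"
    then have "\<bar>g x\<bar> \<le> r" for x using abs_le_norm1_below[of g L x] by auto
    then show "g \<in> box \<inter> {g. norm1_below L g \<le> r}"
      using g by (auto simp: box_def supported_below_def)
  qed (auto simp: box_def supported_below_def PiE_iff not_less split: if_splits)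
  ultimately show ?thesis
    by (simp add: compact_Int_closed closed_Collect_le continuous_intros)
qed

lemma abs_ip_sum_nonneg: "0 \<le> abs_ip_sum \<phi> N g"
  by (simp add: abs_ip_sum_def sum_nonneg)

lemma abs_ip_sum_mono: "N \<le> N' \<Longrightarrow> abs_ip_sum \<phi> N g \<le> abs_ip_sum \<phi> N' g"
  unfolding abs_ip_sum_def by (rule sum_mono2) auto

lemma abs_ip_sum_eq_0_iff: "abs_ip_sum \<phi> N g = 0 \<longleftrightarrow> (\<forall>i<N. ip_fun (\<phi> i) g = 0)"
  by (auto simp: abs_ip_sum_def sum_nonneg_eq_0_iff)

lemma ip_fun_restrict:
  assumes "length \<phi> \<le> L"
  shows "ip_fun \<phi> (\<lambda>x. if x < L then g x else 0) = ip_fun \<phi> g"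
  unfolding ip_fun_def using assms by (intro sum.cong) auto

lemma annihilator_scale: "k \<in> annihilator L \<phi> \<Longrightarrow> (\<lambda>x. c * k x) \<in> annihilator L \<phi>"
  by (simp add: annihilator_def supported_below_def ip_fun_scale)

lemma min_norm_reps_scale:
  assumes g: "g \<in> min_norm_reps L \<phi>"
  shows "(\<lambda>x. c * g x) \<in> min_norm_reps L \<phi>"
proof (cases "c = 0")
  case True
  then show ?thesis
    by (simp add: min_norm_reps_def supported_below_def norm1_below_def sum_nonneg)
next
  case False
  have "norm1_below L (\<lambda>x. c * g x) \<le> norm1_below L (\<lambda>x. c * g x + k x)"
    if k: "k \<in> annihilator L \<phi>" for k
  proof -
    have "(\<lambda>x. c * g x + k x) = (\<lambda>x. c * (g x + inverse c * k x))"
      using False by (simp add: distrib_left mult.assoc[symmetric])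
    moreover have "norm1_below L g \<le> norm1_below L (\<lambda>x. g x + inverse c * k x)"
      using g annihilator_scale[OF k] by (auto simp: min_norm_reps_def)
    ultimately show ?thesis by (simp add: norm1_below_scale mult_left_mono)
  qed
  then show ?thesis using g by (auto simp: min_norm_reps_def supported_below_def)
qed

lemma closed_min_norm_reps: "closed (min_norm_reps L \<phi>)"
proof -
  have "min_norm_reps L \<phi> = supported_below L \<inter>
      (\<Inter>k\<in>annihilator L \<phi>. {g. norm1_below L g \<le> norm1_below L (\<lambda>x. g x + k x)})"
    by (auto simp: min_norm_reps_def)
  moreover have "closed {g. norm1_below L g \<le> norm1_below L (\<lambda>x. g x + k x)}" for k
  proof -
    have "continuous_on UNIV (\<lambda>g. norm1_below L (\<lambda>x. g x + k x))"
      unfolding norm1_below_def by (intro continuous_intros)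
    then show ?thesis by (intro closed_Collect_le continuous_intros)
  qed
  ultimately show ?thesis by (auto intro!: closed_Int closed_INT closed_supported_below)
qed

lemma compact_min_norm_reps_sphere: "compact (min_norm_reps L \<phi> \<inter> {g. norm1_below L g = 1})"
proof -
  have "min_norm_reps L \<phi> \<inter> {g. norm1_below L g = 1} = (supported_below L \<inter> {g. norm1_below L g \<le> 1})
      \<inter> (min_norm_reps L \<phi> \<inter> {g. norm1_below L g = 1})"
    by (auto simp: min_norm_reps_def)
  moreover have "closed (min_norm_reps L \<phi> \<inter> {g. norm1_below L g = 1})"
    by (intro closed_Int closed_min_norm_reps closed_Collect_eq continuous_intros)
  ultimately show ?thesis
    by (metis compact_Int_closed compact_norm1_below_le)
qed

text \<open>The zero sets of \<^term>\<open>abs_ip_sum \<phi> N\<close> decrease to the annihilator, which misses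
  the sphere of minimal representatives; by compactness one of them misses it already.\<close>
lemma abs_ip_sum_nonzero_on_min_norm_sphere:
  "\<exists>N. \<forall>g\<in>min_norm_reps L \<phi> \<inter> {g. norm1_below L g = 1}. abs_ip_sum \<phi> N g \<noteq> 0"
proof -
  define S where "S = min_norm_reps L \<phi> \<inter> {g. norm1_below L g = 1}"
  define Z where "Z N = {g. abs_ip_sum \<phi> N g = 0}" for N
  have "S \<inter> (\<Inter>N. Z N) = {}"
  proof (intro equals0I)
    fix g assume g: "g \<in> S \<inter> (\<Inter>N. Z N)"
    then have "ip_fun (\<phi> i) g = 0" for i
      using abs_ip_sum_eq_0_iff[of \<phi> "Suc i" g] by (auto simp: Z_def)
    then have "(\<lambda>x. - 1 * g x) \<in> annihilator L \<phi>"
      using g by (intro annihilator_scale) (auto simp: annihilator_def S_def min_norm_reps_def)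
    then have "norm1_below L g \<le> 0"
      using g by (auto simp: S_def min_norm_reps_def norm1_below_def)
    then show False using g by (simp add: S_def)
  qed
  moreover have "closed (Z N)" for N
    unfolding Z_def by (intro closed_Collect_eq continuous_intros)
  ultimately obtain I where "finite I" and I: "S \<inter> (\<Inter>N\<in>I. Z N) = {}"
    using compact_imp_fip_image[OF compact_min_norm_reps_sphere[of L \<phi>, folded S_def], of UNIV Z] by auto
  define M where "M = Max (insert 0 I)"
  have "Z M \<subseteq> Z N" if "N \<in> I" for N
  proof
    fix g assume "g \<in> Z M"
    moreover have "N \<le> M" using that \<open>finite I\<close> by (simp add: M_def)
    ultimately show "g \<in> Z N"
      using abs_ip_sum_mono[of N _ \<phi> g] abs_ip_sum_nonneg[of \<phi> N g] by (force simp: Z_def)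
  qed
  with I have "S \<inter> Z M = {}" by blast
  then show ?thesis by (auto simp: S_def Z_def)
qed

lemma min_norm_reps_norm1_le:
  obtains N c where "c > 0" "\<And>g. g \<in> min_norm_reps L \<phi> \<Longrightarrow> c * norm1_below L g \<le> abs_ip_sum \<phi> N g"
proof -
  define S where "S = min_norm_reps L \<phi> \<inter> {g. norm1_below L g = 1}"
  obtain N where N: "\<And>g. g \<in> S \<Longrightarrow> abs_ip_sum \<phi> N g \<noteq> 0"
    using abs_ip_sum_nonzero_on_min_norm_sphere unfolding S_def by blast
  obtain c where "c > 0" and c: "\<And>g. g \<in> S \<Longrightarrow> c \<le> abs_ip_sum \<phi> N g"
  proof (cases "S = {}")
    case False
    then obtain g0 where "g0 \<in> S"
      and g0: "\<And>g. g \<in> S \<Longrightarrow> abs_ip_sum \<phi> N g0 \<le> abs_ip_sum \<phi> N g"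
      using continuous_attains_inf[OF compact_min_norm_reps_sphere[of L \<phi>, folded S_def] _
          continuous_on_abs_ip_sum]
      by blast
    then show thesis
      using that N[OF \<open>g0 \<in> S\<close>] abs_ip_sum_nonneg by (metis order_le_neq_trans)
  qed (use that[of 1] in auto)
  have "c * norm1_below L g \<le> abs_ip_sum \<phi> N g" if g: "g \<in> min_norm_reps L \<phi>" for g
  proof (cases "norm1_below L g = 0")
    case False
    define t where "t = norm1_below L g"
    have "t > 0" using False by (simp add: t_def norm1_below_def sum_nonneg order_le_neq_trans)
    have "(\<lambda>x. inverse t * g x) \<in> S"
      using min_norm_reps_scale[OF g] \<open>t > 0\<close> by (simp add: S_def norm1_below_scale t_def)
    then have "c \<le> abs_ip_sum \<phi> N (\<lambda>x. inverse t * g x)" by (rule c)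
    also have "\<dots> = inverse t * abs_ip_sum \<phi> N g"
      using \<open>t > 0\<close> by (simp add: abs_ip_sum_scale)
    finally show ?thesis using \<open>t > 0\<close> by (simp add: t_def field_simps)
  qed (simp add: abs_ip_sum_nonneg)
  then show thesis using that \<open>c > 0\<close> by blast
qed

context
  fixes L :: nat and \<phi> :: "nat \<Rightarrow> real list"
  assumes length_le: "\<And>i. length (\<phi> i) \<le> L"
begin

lemma min_norm_rep_exists: "\<exists>g'\<in>min_norm_reps L \<phi>. \<forall>i. ip_fun (\<phi> i) g' = ip_fun (\<phi> i) g"
proof -
  define g0 where "g0 = (\<lambda>x. if x < L then g x else 0)"
  define T where "T = (supported_below L \<inter> {g'. norm1_below L g' \<le> norm1_below L g0})
    \<inter> {g'. \<forall>i. ip_fun (\<phi> i) g' = ip_fun (\<phi> i) g}"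
  have "compact T"
    unfolding T_def by (intro compact_Int_closed compact_norm1_below_le closed_Collect_all
        closed_Collect_eq continuous_intros)
  moreover have "g0 \<in> T"
    using ip_fun_restrict[OF length_le] by (simp add: T_def g0_def supported_below_def)
  ultimately obtain g' where "g' \<in> T" and g'_min: "\<And>h. h \<in> T \<Longrightarrow> norm1_below L g' \<le> norm1_below L h"
    using continuous_attains_inf[of T "norm1_below L"] by (auto intro: continuous_intros)
  then have g': "g' \<in> supported_below L" "norm1_below L g' \<le> norm1_below L g0"
    "\<And>i. ip_fun (\<phi> i) g' = ip_fun (\<phi> i) g"
    by (auto simp: T_def)
  have "norm1_below L g' \<le> norm1_below L (\<lambda>x. g' x + k x)" if k: "k \<in> annihilator L \<phi>" for k
  proof (cases "norm1_below L (\<lambda>x. g' x + k x) \<le> norm1_below L g0")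
    case True
    with g' k have "(\<lambda>x. g' x + k x) \<in> T"
      by (auto simp: T_def annihilator_def supported_below_def ip_fun_add)
    then show ?thesis by (rule g'_min)
  qed (use g' in auto)
  then show ?thesis using g' by (auto simp: min_norm_reps_def)
qed

lemma bounded_representative:
  "\<exists>N K. K > 0 \<and> (\<forall>g. \<exists>g'. (\<forall>i. ip_fun (\<phi> i) g' = ip_fun (\<phi> i) g) \<and>
    (\<forall>x. \<bar>g' x\<bar> \<le> K * abs_ip_sum \<phi> N g))"
proof -
  obtain N c where "c > 0" and c: "\<And>g. g \<in> min_norm_reps L \<phi> \<Longrightarrow> c * norm1_below L g \<le> abs_ip_sum \<phi> N g"
    using min_norm_reps_norm1_le by blast
  have "\<exists>g'. (\<forall>i. ip_fun (\<phi> i) g' = ip_fun (\<phi> i) g) \<and> (\<forall>x. \<bar>g' x\<bar> \<le> inverse c * abs_ip_sum \<phi> N g)" for g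
  proof -
    obtain g' where g': "g' \<in> min_norm_reps L \<phi>" "\<And>i. ip_fun (\<phi> i) g' = ip_fun (\<phi> i) g"
      using min_norm_rep_exists by blast
    have "abs_ip_sum \<phi> N g' = abs_ip_sum \<phi> N g" by (simp add: abs_ip_sum_def g'(2))
    moreover have "\<bar>g' x\<bar> \<le> norm1_below L g'" for x
      using g'(1) by (intro abs_le_norm1_below) (simp add: min_norm_reps_def)
    ultimately have "c * \<bar>g' x\<bar> \<le> abs_ip_sum \<phi> N g" for x
      using c[OF g'(1)] \<open>c > 0\<close> by (metis mult_left_mono less_imp_le order_trans)
    then show ?thesis using g'(2) \<open>c > 0\<close> by (auto simp: field_simps)
  qed
  then show ?thesis using \<open>c > 0\<close> by (intro exI[of _ N] exI[of _ "inverse c"]) auto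
qed

end

section \<open>Stable state-space systems\<close>

text \<open>Asymptotic stability is stated pointwise; summing over a basis makes the decay uniform.\<close>
definition iter_gain :: "real^'n^'n \<Rightarrow> nat \<Rightarrow> real" where
  "iter_gain A k = (\<Sum>b\<in>Basis. norm ((((*v) A) ^^ k) b))"

lemma linear_iter_matrix: "linear (((*v) (A::real^'n^'n)) ^^ k)"
proof (induction k)
  case 0
  then show ?case by (simp add: linear_id[unfolded id_def])
next
  case (Suc k)
  then show ?case
    unfolding funpow.simps(2) by (rule linear_compose[OF _ matrix_vector_mul_linear])
qed

lemma iter_gain_nonneg: "0 \<le> iter_gain A k"
  by (simp add: iter_gain_def sum_nonneg)

lemma norm_iter_matrix_le:
  fixes A :: "real^'n^'n"
  shows "norm ((((*v) A) ^^ k) x) \<le> iter_gain A k * norm x"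
proof -
  let ?f = "((*v) A) ^^ k"
  have "?f x = ?f (\<Sum>b\<in>Basis. (x \<bullet> b) *\<^sub>R b)"
    by (simp add: euclidean_representation)
  also have "\<dots> = (\<Sum>b\<in>Basis. (x \<bullet> b) *\<^sub>R ?f b)"
    using linear_iter_matrix[of k A] by (simp add: linear_sum linear_scale)
  finally have "norm (?f x) \<le> (\<Sum>b\<in>Basis. norm ((x \<bullet> b) *\<^sub>R ?f b))"
    by (metis norm_sum)
  also have "\<dots> \<le> (\<Sum>b\<in>Basis. norm x * norm (?f b))"
    by (intro sum_mono) (simp add: Basis_le_norm mult_right_mono)
  finally show ?thesis by (simp add: iter_gain_def sum_distrib_left mult.commute)
qed

lemma asympt_stable_iter_gain: "asympt_stable A \<Longrightarrow> iter_gain A \<longlonglongrightarrow> 0"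
  unfolding asympt_stable_def iter_gain_def
  using tendsto_sum[of Basis "\<lambda>b k. norm ((((*v) A) ^^ k) b)" "\<lambda>_. 0"]
  by (simp add: tendsto_norm_zero)

lemma traj_variation_of_constants:
  assumes "traj A B U d0 x u d"
  shows "x (k + int j) = (((*v) A) ^^ j) (x k)
    + (\<Sum>i<j. u (k + int j - 1 - int i) *\<^sub>R ((((*v) A) ^^ i) B))"
proof (induction j)
  case 0
  then show ?case by simp
next
  case (Suc j)
  have step: "x (k + int j + 1) = A *v x (k + int j) + u (k + int j) *\<^sub>R B"
    using assms unfolding traj_def by blast
  have "A *v (\<Sum>i<j. u (k + int j - 1 - int i) *\<^sub>R ((((*v) A) ^^ i) B))
      = (\<Sum>i<j. u (k + int j - 1 - int i) *\<^sub>R (A *v (((*v) A) ^^ i) B))"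
    using matrix_vector_mul_linear[of A] by (simp add: linear_sum linear_scale)
  then have "x (k + int (Suc j)) = (((*v) A) ^^ Suc j) (x k) + u (k + int j) *\<^sub>R B
      + (\<Sum>i<j. u (k + int j - 1 - int i) *\<^sub>R ((((*v) A) ^^ Suc i) B))"
    using step Suc by (simp add: matrix_vector_right_distrib algebra_simps)
  also have "\<dots> = (((*v) A) ^^ Suc j) (x k)
      + (\<Sum>i<Suc j. u (k + int (Suc j) - 1 - int i) *\<^sub>R ((((*v) A) ^^ i) B))"
    by (subst sum.lessThan_Suc_shift) (simp add: algebra_simps)
  finally show ?case .
qed

lemma traj_norm_le:
  fixes A :: "real^'n^'n"
  assumes tr: "traj A B U d0 x u d" and U: "\<And>v. v \<in> U \<Longrightarrow> \<bar>v\<bar> \<le> Ub"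
  shows "norm (x (k + int j)) \<le> iter_gain A j * norm (x k) + (\<Sum>i<j. Ub * norm ((((*v) A) ^^ i) B))"
proof -
  have "norm (\<Sum>i<j. u (k + int j - 1 - int i) *\<^sub>R ((((*v) A) ^^ i) B))
      \<le> (\<Sum>i<j. Ub * norm ((((*v) A) ^^ i) B))"
    using tr U unfolding traj_def
    by (intro order_trans[OF norm_sum] sum_mono) (auto intro: mult_right_mono)
  then show ?thesis
    using traj_variation_of_constants[OF tr, of k j] norm_iter_matrix_le[of j A "x k"]
    by (smt (verit) norm_triangle_ineq)
qed

text \<open>After K steps with gain below 1/2, the supremum s of a bounded trajectory satisfies
  s \<le> s/2 + W, where W bounds the response to K inputs.\<close>
lemma traj_state_bounded:
  assumes stable: "asympt_stable A" and "compact U"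
  obtains X where "\<And>x u d k. traj A B U d0 x u d \<Longrightarrow> norm (x k) \<le> X"
proof -
  obtain Ub where Ub: "\<And>v. v \<in> U \<Longrightarrow> \<bar>v\<bar> \<le> Ub"
    using compact_imp_bounded[OF \<open>compact U\<close>] by (auto simp: bounded_iff)
  obtain K where K: "iter_gain A K < 1/2"
    using order_tendstoD(2)[OF asympt_stable_iter_gain[OF stable], of "1/2"]
    by (auto simp: eventually_sequentially)
  define W where "W = (\<Sum>i<K. Ub * norm ((((*v) A) ^^ i) B))"
  have "norm (x k) \<le> 2 * W" if tr: "traj A B U d0 x u d" for x u d k
  proof -
    define s where "s = (SUP k. norm (x k))"
    have bdd: "bdd_above (range (\<lambda>k. norm (x k)))"
      using tr by (auto simp: traj_def bounded_iff intro: bdd_aboveI)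
    have "norm (x j) \<le> s / 2 + W" for j
    proof -
      have "norm (x j) \<le> iter_gain A K * norm (x (j - int K)) + W"
        using traj_norm_le[OF tr Ub, of "j - int K" K] by (simp add: W_def)
      moreover have "norm (x (j - int K)) \<le> s"
        unfolding s_def by (rule cSUP_upper[OF _ bdd]) simp
      then have "iter_gain A K * norm (x (j - int K)) \<le> 1/2 * s"
        using K iter_gain_nonneg[of A K] by (intro mult_mono) auto
      ultimately show ?thesis by simp
    qed
    then have "s \<le> s / 2 + W"
      unfolding s_def by (intro cSUP_least) auto
    moreover have "norm (x k) \<le> s"
      unfolding s_def by (rule cSUP_upper[OF _ bdd]) simp
    ultimately show ?thesis by simp
  qed
  then show thesis by (rule that)
qed

section \<open>Worst-case costs and the linear program\<close>

lemma sum_lessThan_add: "(\<Sum>i<m + n. f i) = (\<Sum>i<m. f i) + (\<Sum>i<n. f (m + i :: nat))"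
  by (induction n) (simp_all add: add.assoc)

lemma ip_append: "length a = length c \<Longrightarrow> ip (a @ b) (c @ e) = ip a c + ip b e"
  unfolding ip_def by (simp add: sum_lessThan_add nth_append)

lemma abs_ip_le:
  assumes "\<And>j. j < length \<phi> \<Longrightarrow> \<bar>\<phi> ! j\<bar> \<le> M"
  shows "\<bar>ip \<phi> \<theta>\<bar> \<le> M * (\<Sum>j<length \<phi>. \<bar>\<theta> ! j\<bar>)"
proof -
  have "\<bar>ip \<phi> \<theta>\<bar> \<le> (\<Sum>j<length \<phi>. \<bar>\<phi> ! j\<bar> * \<bar>\<theta> ! j\<bar>)"
    unfolding ip_def abs_mult[symmetric] by (rule sum_abs)
  also have "\<dots> \<le> (\<Sum>j<length \<phi>. M * \<bar>\<theta> ! j\<bar>)"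
    using assms by (intro sum_mono mult_right_mono) auto
  finally show ?thesis by (simp add: sum_distrib_left)
qed

lemma abs_ip_diff_le:
  assumes "length a = L" "length b = L"
    and "\<And>j. j < L \<Longrightarrow> \<bar>a ! j - b ! j\<bar> \<le> \<beta>" "\<And>j. j < L \<Longrightarrow> \<bar>\<theta> ! j\<bar> \<le> R"
  shows "\<bar>ip a \<theta> - ip b \<theta>\<bar> \<le> L * (\<beta> * R)"
proof -
  have "ip a \<theta> - ip b \<theta> = (\<Sum>j<L. (a ! j - b ! j) * \<theta> ! j)"
    unfolding ip_def assms(1,2) by (simp add: sum_subtractf left_diff_distrib)
  also have "\<bar>\<dots>\<bar> \<le> (\<Sum>j<L. \<bar>a ! j - b ! j\<bar> * \<bar>\<theta> ! j\<bar>)"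
    unfolding abs_mult[symmetric] by (rule sum_abs)
  also have "\<dots> \<le> (\<Sum>j<L. \<beta> * R)"
    using assms(3,4) by (intro sum_mono mult_mono') auto
  finally show ?thesis by simp
qed

lemma vdist_le_imp_nth_le:
  assumes "vdist v w \<le> \<beta>" "j < length (fst v)"
  shows "\<bar>fst v ! j - fst w ! j\<bar> \<le> \<beta>"
proof -
  have "(fst v ! j - fst w ! j)\<^sup>2 \<le> (\<Sum>i<length (fst v). (fst v ! i - fst w ! i)\<^sup>2)"
    by (rule member_le_sum) (use assms(2) in auto)
  also have "\<dots> \<le> (\<Sum>i<length (fst v). (fst v ! i - fst w ! i)\<^sup>2) + (snd v - snd w)\<^sup>2"
    by simp
  finally have "\<bar>fst v ! j - fst w ! j\<bar> \<le> vdist v w"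
    unfolding vdist_def by (metis power2_abs real_le_rsqrt)
  then show ?thesis using assms(1) by simp
qed

lemma vdist_le_imp_snd_le:
  assumes "vdist v w \<le> \<beta>"
  shows "\<bar>snd v - snd w\<bar> \<le> \<beta>"
proof -
  have "\<bar>snd v - snd w\<bar> \<le> vdist v w"
    unfolding vdist_def by (intro real_le_rsqrt) (simp add: sum_nonneg)
  then show ?thesis using assms by simp
qed

lemma nth_Zvec_append_Uvec:
  "j < 2 * m + p - 1 \<Longrightarrow> (Zvec m z k @ Uvec p m u k) ! j =
     (if j < m then z (k - int j) else u (k + int p - 1 - int (j - m)))"
  by (auto simp: Zvec_def Uvec_def nth_append)

lemma length_Zvec_append_Uvec: "length (Zvec m z k @ Uvec p m u k) = 2 * m + p - 1"
  by (simp add: Zvec_def Uvec_def)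

lemma ip_fun_nth_map: "length \<phi> \<le> L \<Longrightarrow> ip_fun \<phi> ((!) (map g [0..<L])) = ip_fun \<phi> g"
  unfolding ip_fun_def by (intro sum.cong) auto

lemma bounded_refit:
  fixes s :: "nat \<Rightarrow> real list \<times> real"
  assumes len: "\<And>i. i \<ge> 1 \<Longrightarrow> length (fst (s i)) = L"
  shows "\<exists>N0 K. K > 0 \<and> (\<forall>\<theta> (Q::real). length \<theta> = L \<longrightarrow> (\<forall>i\<in>{1..N0}. \<bar>ip (fst (s i)) \<theta>\<bar> \<le> Q) \<longrightarrow>
    (\<exists>\<theta>'. length \<theta>' = L \<and> (\<forall>i\<ge>1. ip (fst (s i)) \<theta>' = ip (fst (s i)) \<theta>)
      \<and> (\<forall>j<L. \<bar>\<theta>' ! j\<bar> \<le> K * (real N0 * Q))))"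
proof -
  define \<phi> where "\<phi> i = fst (s (Suc i))" for i
  have len_\<phi>: "length (\<phi> i) \<le> L" for i using len by (simp add: \<phi>_def)
  from bounded_representative[where L = L and \<phi> = \<phi>, OF len_\<phi>]
  obtain N0 K where "K > 0" and rep: "\<And>g. \<exists>g'. (\<forall>i. ip_fun (\<phi> i) g' = ip_fun (\<phi> i) g)
      \<and> (\<forall>x. \<bar>g' x\<bar> \<le> K * abs_ip_sum \<phi> N0 g)"
    by blast
  have "\<exists>\<theta>'. length \<theta>' = L \<and> (\<forall>i\<ge>1. ip (fst (s i)) \<theta>' = ip (fst (s i)) \<theta>)
      \<and> (\<forall>j<L. \<bar>\<theta>' ! j\<bar> \<le> K * (real N0 * Q))"
    if \<theta>: "length \<theta> = L" and fit: "\<And>i. i \<in> {1..N0} \<Longrightarrow> \<bar>ip (fst (s i)) \<theta>\<bar> \<le> Q" for \<theta> Q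
  proof -
    obtain g' where g': "\<And>i. ip_fun (\<phi> i) g' = ip_fun (\<phi> i) ((!) \<theta>)"
      "\<And>x. \<bar>g' x\<bar> \<le> K * abs_ip_sum \<phi> N0 ((!) \<theta>)"
      using rep by blast
    have "\<bar>ip_fun (\<phi> i) ((!) \<theta>)\<bar> \<le> Q" if "i < N0" for i
      using fit[of "Suc i"] that by (simp add: \<phi>_def ip_eq_ip_fun)
    then have "abs_ip_sum \<phi> N0 ((!) \<theta>) \<le> real N0 * Q"
      unfolding abs_ip_sum_def using sum_mono[of "{..<N0}" _ "\<lambda>_. Q"] by simp
    then have "\<bar>g' x\<bar> \<le> K * (real N0 * Q)" for x
      using g'(2)[of x] \<open>K > 0\<close> by (meson mult_left_mono order_trans less_imp_le)
    moreover have "ip (fst (s i)) (map g' [0..<L]) = ip (fst (s i)) \<theta>" if "i \<ge> 1" for i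
    proof -
      have "fst (s i) = \<phi> (i - 1)" using that by (simp add: \<phi>_def)
      then show ?thesis
        using g'(1)[of "i - 1"] ip_fun_nth_map[of "fst (s i)" L g'] len[OF that]
        by (simp add: ip_eq_ip_fun)
    qed
    ultimately show ?thesis by (intro exI[of _ "map g' [0..<L]"]) auto
  qed
  then show ?thesis using \<open>K > 0\<close> by blast
qed

lemma cost_le_of_dense_samples:
  fixes V :: "(real list \<times> real) set" and s :: "nat \<Rightarrow> real list \<times> real"
  assumes "V \<noteq> {}"
    and len_V: "\<And>v. v \<in> V \<Longrightarrow> length (fst v) = L"
    and len_s: "\<And>i. i \<in> I \<Longrightarrow> length (fst (s i)) = L"
    and dense: "\<And>v. v \<in> V \<Longrightarrow> \<exists>i\<in>I. vdist (s i) v \<le> \<beta>"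
    and fit: "\<And>i. i \<in> I \<Longrightarrow> \<bar>snd (s i) - ip (fst (s i)) \<theta>\<bar> \<le> lam + dbar"
    and bounded: "\<And>j. j < L \<Longrightarrow> \<bar>\<theta> ! j\<bar> \<le> R"
  shows "cost V dbar \<theta> \<le> lam + \<beta> * (1 + L * R)"
  unfolding cost_def
proof (rule cSUP_least)
  fix v assume v: "v \<in> V"
  then obtain i where i: "i \<in> I" and close: "vdist (s i) v \<le> \<beta>" using dense by blast
  have "\<bar>ip (fst (s i)) \<theta> - ip (fst v) \<theta>\<bar> \<le> L * (\<beta> * R)"
    using vdist_le_imp_nth_le[OF close] len_s[OF i]
    by (intro abs_ip_diff_le[OF len_s[OF i] len_V[OF v] _ bounded]) auto
  moreover have "\<bar>snd (s i) - snd v\<bar> \<le> \<beta>" by (rule vdist_le_imp_snd_le[OF close])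
  moreover have "\<beta> * (1 + L * R) = \<beta> + L * (\<beta> * R)" by (simp add: algebra_simps)
  ultimately show "\<bar>snd v - ip (fst v) \<theta>\<bar> - dbar \<le> lam + \<beta> * (1 + L * R)"
    using fit[OF i] by linarith
qed (fact)

lemma lambda_low_le:
  assumes "0 \<le> lam" "length \<theta> = 2 * m + p - 1"
    and "\<And>i. i \<in> {1..N} \<Longrightarrow> \<bar>snd (data p i) - ip (fst (data p i)) \<theta>\<bar> \<le> lam + dbar"
  shows "lambda_low dbar m data p N \<le> lam"
  unfolding lambda_low_def using assms by (intro cInf_lower bdd_belowI[of _ 0]) auto

lemma lambda_low_greatest:
  assumes "\<And>lam \<theta>. 0 \<le> lam \<Longrightarrow> length \<theta> = 2 * m + p - 1 \<Longrightarrow>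
      (\<And>i. i \<in> {1..N} \<Longrightarrow> \<bar>snd (data p i) - ip (fst (data p i)) \<theta>\<bar> \<le> lam + dbar) \<Longrightarrow> b \<le> lam"
  shows "b \<le> lambda_low dbar m data p N"
  unfolding lambda_low_def
proof (rule cInf_greatest)
  let ?\<theta> = "replicate (2 * m + p - 1) 0"
  let ?r = "\<lambda>i. \<bar>snd (data p i) - ip (fst (data p i)) ?\<theta>\<bar>"
  have "?r i \<le> (\<Sum>i\<in>{1..N}. ?r i) + \<bar>dbar\<bar> + dbar" if "i \<in> {1..N}" for i
    using member_le_sum[of i "{1..N}" ?r] that by simp
  then have "(\<Sum>i\<in>{1..N}. ?r i) + \<bar>dbar\<bar> \<in> {lam. lam \<ge> 0 \<and> (\<exists>\<theta>. length \<theta> = 2 * m + p - 1 \<and>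
      (\<forall>i\<in>{1..N}. \<bar>snd (data p i) - ip (fst (data p i)) \<theta>\<bar> \<le> lam + dbar))}"
    by (auto intro!: exI[of _ ?\<theta>] sum_nonneg)
  then show "{lam. lam \<ge> 0 \<and> (\<exists>\<theta>. length \<theta> = 2 * m + p - 1 \<and>
      (\<forall>i\<in>{1..N}. \<bar>snd (data p i) - ip (fst (data p i)) \<theta>\<bar> \<le> lam + dbar))} \<noteq> {}"
    by blast
qed (use assms in blast)

section \<open>The identification setting\<close>

definition markov_theta :: "real^'n^'n \<Rightarrow> real^'n \<Rightarrow> real^'n \<Rightarrow> nat \<Rightarrow> nat \<Rightarrow> real list" where
  "markov_theta A B C m p = replicate m 0 @ map (\<lambda>i. C \<bullet> ((((*v) A) ^^ i) B)) [0..<p + m - 1]"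

lemma length_markov_theta: "length (markov_theta A B C m p) = 2 * m + p - 1"
  by (simp add: markov_theta_def)

locale stable_plant =
  fixes A :: "real^'n^'n" and B C :: "real^'n" and U :: "real set" and d0 :: real
  assumes stable: "asympt_stable A" and compact_U: "compact U" and d0_nonneg: "0 \<le> d0"
begin

abbreviation V :: "nat \<Rightarrow> nat \<Rightarrow> (real list \<times> real) set" where
  "V \<equiv> V_set A B C U d0"

lemma V_setE:
  assumes "(\<phi>, y) \<in> V m p"
  obtains x u d k where "traj A B U d0 x u d" "\<phi> \<in> Phi_set A B C U d0 m p"
    "\<phi> = Zvec m (\<lambda>j. C \<bullet> x j + d j) k @ Uvec p m u k" "y = C \<bullet> x (k + int p) + d (k + int p)"
proof -
  from assms have "\<phi> \<in> Phi_set A B C U d0 m p" "y \<in> Y_set A B C U d0 m p \<phi>"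
    by (simp_all add: V_set_def)
  then show thesis unfolding Y_set_def using that by blast
qed

lemma length_V_set:
  assumes "v \<in> V m p"
  shows "length (fst v) = 2 * m + p - 1"
proof -
  obtain \<phi> y where v: "v = (\<phi>, y)" by fastforce
  with assms obtain x u d k where "\<phi> = Zvec m (\<lambda>j. C \<bullet> x j + d j) k @ Uvec p m u k"
    by (auto elim: V_setE)
  then show ?thesis by (simp add: v length_Zvec_append_Uvec del: length_append)
qed

lemma V_set_bounded:
  obtains M where "\<And>m p v. v \<in> V m p \<Longrightarrow> \<bar>snd v\<bar> \<le> M"
    and "\<And>m p v j. v \<in> V m p \<Longrightarrow> j < length (fst v) \<Longrightarrow> \<bar>fst v ! j\<bar> \<le> M"
proof -
  obtain X where X: "\<And>x u d k. traj A B U d0 x u d \<Longrightarrow> norm (x k) \<le> X"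
    using traj_state_bounded[OF stable compact_U] by blast
  obtain Ub where Ub: "\<And>v. v \<in> U \<Longrightarrow> \<bar>v\<bar> \<le> Ub"
    using compact_imp_bounded[OF compact_U] by (auto simp: bounded_iff)
  define M where "M = norm C * \<bar>X\<bar> + d0 + \<bar>Ub\<bar>"
  have output_le: "\<bar>C \<bullet> x j + d j\<bar> \<le> M" if tr: "traj A B U d0 x u d" for x u d j
  proof -
    have "\<bar>C \<bullet> x j\<bar> \<le> norm C * norm (x j)" by (rule Cauchy_Schwarz_ineq2)
    also have "\<dots> \<le> norm C * \<bar>X\<bar>" using X[OF tr, of j] by (intro mult_left_mono) auto
    finally have "\<bar>C \<bullet> x j\<bar> \<le> norm C * \<bar>X\<bar>" .
    moreover have "\<bar>d j\<bar> \<le> d0" using tr by (simp add: traj_def)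
    ultimately show ?thesis
      unfolding M_def using abs_triangle_ineq[of "C \<bullet> x j" "d j"] abs_ge_zero[of Ub] by linarith
  qed
  have input_le: "\<bar>u j\<bar> \<le> M" if tr: "traj A B U d0 x u d" for x u d j
    using tr Ub[of "u j"] d0_nonneg by (auto simp: traj_def M_def intro: add_increasing)
  show thesis
  proof (rule that)
    fix m p v assume "v \<in> V m p"
    then show "\<bar>snd v\<bar> \<le> M" by (cases v) (auto elim!: V_setE intro: output_le)
  next
    fix m p v j assume v: "v \<in> V m p" and j: "j < length (fst v)"
    from v obtain x u d k where tr: "traj A B U d0 x u d"
      and \<phi>: "fst v = Zvec m (\<lambda>j. C \<bullet> x j + d j) k @ Uvec p m u k"
      by (cases v) (auto elim!: V_setE)
    have "j < 2 * m + p - 1" using j length_V_set[OF v] by simp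
    then show "\<bar>fst v ! j\<bar> \<le> M"
      using output_le[OF tr] input_le[OF tr] by (simp add: \<phi> nth_Zvec_append_Uvec)
  qed
qed

lemma bdd_above_residuals: "bdd_above ((\<lambda>v. \<bar>snd v - ip (fst v) \<theta>\<bar> - dbar) ` V m p)"
proof -
  obtain M where M: "\<And>v. v \<in> V m p \<Longrightarrow> \<bar>snd v\<bar> \<le> M"
    "\<And>v j. v \<in> V m p \<Longrightarrow> j < length (fst v) \<Longrightarrow> \<bar>fst v ! j\<bar> \<le> M"
    using V_set_bounded by metis
  have "\<bar>snd v - ip (fst v) \<theta>\<bar> - dbar \<le> M + M * (\<Sum>j<2 * m + p - 1. \<bar>\<theta> ! j\<bar>) - dbar"
    if v: "v \<in> V m p" for v
    using M(1)[OF v] abs_ip_le[of "fst v" M \<theta>, OF M(2)[OF v]] length_V_set[OF v] by simp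
  then show ?thesis by (intro bdd_aboveI) blast
qed

lemma residual_le_cost: "v \<in> V m p \<Longrightarrow> \<bar>snd v - ip (fst v) \<theta>\<bar> - dbar \<le> cost (V m p) dbar \<theta>"
  unfolding cost_def by (rule cSUP_upper[OF _ bdd_above_residuals])

lemma noise_bound_le_cost:
  assumes "V m p \<noteq> {}" "p \<ge> 1"
  shows "d0 - dbar \<le> cost (V m p) dbar \<theta>"
proof -
  obtain \<phi> y where "(\<phi>, y) \<in> V m p" using assms(1) by auto
  then obtain x u d k where tr: "traj A B U d0 x u d" and \<phi>: "\<phi> \<in> Phi_set A B C U d0 m p"
    and \<phi>_eq: "\<phi> = Zvec m (\<lambda>j. C \<bullet> x j + d j) k @ Uvec p m u k"
    by (rule V_setE)
  define e where "e = C \<bullet> x (k + int p) - ip \<phi> \<theta>"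
  define d' where "d' = d(k + int p := (if e \<ge> 0 then d0 else - d0))"
  have tr': "traj A B U d0 x u d'"
    using tr d0_nonneg unfolding traj_def d'_def by auto
  have "Zvec m (\<lambda>j. C \<bullet> x j + d' j) k = Zvec m (\<lambda>j. C \<bullet> x j + d j) k"
    unfolding Zvec_def d'_def using assms(2) by auto
  then have "C \<bullet> x (k + int p) + d' (k + int p) \<in> Y_set A B C U d0 m p \<phi>"
    unfolding Y_set_def \<phi>_eq using tr' by blast
  with \<phi> have "(\<phi>, C \<bullet> x (k + int p) + d' (k + int p)) \<in> V m p"
    unfolding V_set_def by blast
  from residual_le_cost[OF this, of \<theta> dbar]
  have "\<bar>C \<bullet> x (k + int p) + d' (k + int p) - ip \<phi> \<theta>\<bar> - dbar \<le> cost (V m p) dbar \<theta>"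
    by simp
  moreover have "d0 \<le> \<bar>C \<bullet> x (k + int p) + d' (k + int p) - ip \<phi> \<theta>\<bar>"
    unfolding d'_def using d0_nonneg e_def by auto
  ultimately show ?thesis by simp
qed

lemma cost_markov_theta_le:
  assumes X: "\<And>x u d k. traj A B U d0 x u d \<Longrightarrow> norm (x k) \<le> X"
    and "m \<ge> 1" "V m p \<noteq> {}"
  shows "cost (V m p) dbar (markov_theta A B C m p)
    \<le> d0 - dbar + norm C * (iter_gain A (p + m - 1) * X)"
  unfolding cost_def
proof (rule cSUP_least)
  show "V m p \<noteq> {}" by fact
next
  fix v assume "v \<in> V m p"
  then obtain x u d k where tr: "traj A B U d0 x u d"
    and \<phi>: "fst v = Zvec m (\<lambda>j. C \<bullet> x j + d j) k @ Uvec p m u k"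
    and y: "snd v = C \<bullet> x (k + int p) + d (k + int p)"
    by (cases v) (auto elim!: V_setE)
  let ?q = "p + m - 1" and ?F = "(*v) A"
  define k' where "k' = k - int (m - 1)"
  have shift: "k' + int ?q = k + int p" using \<open>m \<ge> 1\<close> by (simp add: k'_def)
  have x: "x (k + int p) = (?F ^^ ?q) (x k')
      + (\<Sum>i<?q. u (k + int p - 1 - int i) *\<^sub>R ((?F ^^ i) B))"
    using traj_variation_of_constants[OF tr, of k' ?q] unfolding shift .
  have "ip (fst v) (markov_theta A B C m p)
      = C \<bullet> (\<Sum>i<?q. u (k + int p - 1 - int i) *\<^sub>R ((?F ^^ i) B))"
    unfolding \<phi> markov_theta_def
    by (subst ip_append) (simp_all add: Zvec_def Uvec_def ip_def inner_sum_right)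
  then have "snd v - ip (fst v) (markov_theta A B C m p) = C \<bullet> (?F ^^ ?q) (x k') + d (k + int p)"
    unfolding y x by (simp add: inner_add_right)
  moreover have "\<bar>C \<bullet> (?F ^^ ?q) (x k')\<bar> \<le> norm C * (iter_gain A ?q * X)"
  proof -
    have "\<bar>C \<bullet> (?F ^^ ?q) (x k')\<bar> \<le> norm C * norm ((?F ^^ ?q) (x k'))"
      by (rule Cauchy_Schwarz_ineq2)
    also have "\<dots> \<le> norm C * (iter_gain A ?q * X)"
      using norm_iter_matrix_le[of ?q A "x k'"] X[OF tr, of k'] iter_gain_nonneg[of A ?q]
      by (intro mult_left_mono) (auto intro: order_trans mult_left_mono)
    finally show ?thesis .
  qed
  moreover have "\<bar>d (k + int p)\<bar> \<le> d0" using tr by (simp add: traj_def)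
  ultimately show "\<bar>snd v - ip (fst v) (markov_theta A B C m p)\<bar> - dbar
      \<le> d0 - dbar + norm C * (iter_gain A ?q * X)"
    by simp
qed

definition opt_cost :: "nat \<Rightarrow> real \<Rightarrow> nat \<Rightarrow> real" where
  "opt_cost m dbar p = (INF \<theta>\<in>{\<theta>. length \<theta> = 2 * m + p - 1}. cost (V m p) dbar \<theta>)"

lemma params_nonempty: "{\<theta>::real list. length \<theta> = L} \<noteq> {}"
  by (metis (mono_tags) empty_iff length_replicate mem_Collect_eq)

lemma opt_cost_le_cost:
  assumes "V m p \<noteq> {}" "p \<ge> 1" "length \<theta> = 2 * m + p - 1"
  shows "opt_cost m dbar p \<le> cost (V m p) dbar \<theta>"
proof -
  have "bdd_below (cost (V m p) dbar ` {\<theta>. length \<theta> = 2 * m + p - 1})"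
    using noise_bound_le_cost[OF assms(1,2)] by (rule bdd_belowI2)
  then show ?thesis
    unfolding opt_cost_def by (rule cINF_lower) (simp add: assms(3))
qed

lemma noise_bound_le_opt_cost:
  assumes "V m p \<noteq> {}" "p \<ge> 1"
  shows "d0 - dbar \<le> opt_cost m dbar p"
  unfolding opt_cost_def
  using assms noise_bound_le_cost params_nonempty by (intro cINF_greatest) auto

lemma opt_cost_tendsto:
  assumes "m \<ge> 1" and V_ne: "\<And>p. p \<ge> 1 \<Longrightarrow> V m p \<noteq> {}"
  shows "opt_cost m dbar \<longlonglongrightarrow> d0 - dbar"
proof -
  obtain X where X: "\<And>x u d k. traj A B U d0 x u d \<Longrightarrow> norm (x k) \<le> X"
    using traj_state_bounded[OF stable compact_U] by blast
  define h where "h p = d0 - dbar + norm C * (iter_gain A (p + (m - 1)) * X)" for p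
  have "opt_cost m dbar p \<le> h p" if "p \<ge> 1" for p
  proof -
    have "cost (V m p) dbar (markov_theta A B C m p)
        \<le> d0 - dbar + norm C * (iter_gain A (p + m - 1) * X)"
      by (rule cost_markov_theta_le) (use X \<open>m \<ge> 1\<close> V_ne[OF that] in auto)
    then show ?thesis
      using opt_cost_le_cost[OF V_ne[OF that] that length_markov_theta[of A B C m p], of dbar]
        \<open>m \<ge> 1\<close>
      by (simp add: h_def)
  qed
  then have upper: "\<forall>\<^sub>F p in sequentially. opt_cost m dbar p \<le> h p"
    unfolding eventually_sequentially by (intro exI[of _ 1]) auto
  have lower: "\<forall>\<^sub>F p in sequentially. d0 - dbar \<le> opt_cost m dbar p"
    unfolding eventually_sequentially using noise_bound_le_opt_cost V_ne by (intro exI[of _ 1]) auto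
  have "(\<lambda>p. iter_gain A (p + (m - 1))) \<longlonglongrightarrow> 0"
    by (rule LIMSEQ_ignore_initial_segment[OF asympt_stable_iter_gain[OF stable]])
  then have "h \<longlonglongrightarrow> d0 - dbar + norm C * (0 * X)"
    unfolding h_def by (intro tendsto_add tendsto_const tendsto_mult_left tendsto_mult_right)
  then have "h \<longlonglongrightarrow> d0 - dbar" by simp
  with lower upper show ?thesis
    by (rule real_tendsto_sandwich[OF _ _ tendsto_const])
qed

lemma lambda_low_le_opt_cost:
  assumes "V m p \<noteq> {}" "p \<ge> 1" "\<And>i. i \<in> {1..N} \<Longrightarrow> data p i \<in> V m p"
    and "0 \<le> opt_cost m dbar p"
  shows "lambda_low dbar m data p N \<le> opt_cost m dbar p"
proof -
  have "lambda_low dbar m data p N \<le> cost (V m p) dbar \<theta>" if \<theta>: "length \<theta> = 2 * m + p - 1" for \<theta>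
  proof (rule lambda_low_le[OF _ \<theta>])
    show "0 \<le> cost (V m p) dbar \<theta>"
      using assms(4) opt_cost_le_cost[OF assms(1,2) \<theta>, of dbar] by linarith
  next
    fix i assume "i \<in> {1..N}"
    then show "\<bar>snd (data p i) - ip (fst (data p i)) \<theta>\<bar> \<le> cost (V m p) dbar \<theta> + dbar"
      using residual_le_cost[where \<theta> = \<theta> and dbar = dbar, OF assms(3)] by fastforce
  qed
  then show ?thesis
    unfolding opt_cost_def using params_nonempty by (intro cINF_greatest) auto
qed

lemma opt_cost_le_fit_of_dense_samples:
  fixes data :: "nat \<Rightarrow> nat \<Rightarrow> real list \<times> real"
  assumes p: "p \<ge> 1" and data: "\<And>i. i \<ge> 1 \<Longrightarrow> data p i \<in> V m p"
    and dense: "\<And>v. v \<in> V m p \<Longrightarrow> \<exists>i\<in>{1..N}. vdist (data p i) v \<le> \<beta>"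
    and fit: "\<And>i. i \<in> {1..N} \<Longrightarrow> \<bar>snd (data p i) - ip (fst (data p i)) \<theta>\<bar> \<le> lam + dbar"
    and \<theta>: "length \<theta> = 2 * m + p - 1"
    and bounded: "\<And>j. j < 2 * m + p - 1 \<Longrightarrow> \<bar>\<theta> ! j\<bar> \<le> R"
  shows "opt_cost m dbar p \<le> lam + \<beta> * (1 + real (2 * m + p - 1) * R)"
proof -
  have "data p 1 \<in> V m p" by (rule data) simp
  then have V_ne: "V m p \<noteq> {}" by blast
  have len: "length (fst (data p i)) = 2 * m + p - 1" if "i \<in> {1..N}" for i
    using that by (intro length_V_set data) simp
  have "opt_cost m dbar p \<le> cost (V m p) dbar \<theta>"
    by (rule opt_cost_le_cost[OF V_ne p \<theta>])
  also have "\<dots> \<le> lam + \<beta> * (1 + real (2 * m + p - 1) * R)"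
    by (rule cost_le_of_dense_samples[OF V_ne length_V_set len dense fit bounded])
  finally show ?thesis .
qed

lemma opt_cost_le_lambda_low:
  assumes p: "p \<ge> 1" and data: "\<And>i. i \<ge> 1 \<Longrightarrow> data p i \<in> V m p"
    and informative: "\<And>\<beta>. \<beta> > 0 \<Longrightarrow> \<exists>N. \<forall>v\<in>V m p. \<exists>i\<in>{1..N}. vdist (data p i) v \<le> \<beta>"
    and "0 < \<eta>"
  shows "\<exists>N. opt_cost m dbar p - \<eta> \<le> lambda_low dbar m data p N"
proof -
  let ?L = "2 * m + p - 1" and ?lam = "opt_cost m dbar p"
  obtain M where M: "\<And>v. v \<in> V m p \<Longrightarrow> \<bar>snd v\<bar> \<le> M"
    using V_set_bounded by metis
  from bounded_refit[of "data p" ?L] length_V_set data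
  obtain N0 K where "K > 0" and refit: "\<And>\<theta> Q. length \<theta> = ?L \<Longrightarrow>
      \<forall>i\<in>{1..N0}. \<bar>ip (fst (data p i)) \<theta>\<bar> \<le> Q \<Longrightarrow>
      \<exists>\<theta>'. length \<theta>' = ?L \<and> (\<forall>i\<ge>1. ip (fst (data p i)) \<theta>' = ip (fst (data p i)) \<theta>)
        \<and> (\<forall>j<?L. \<bar>\<theta>' ! j\<bar> \<le> K * (real N0 * Q))"
    by blast
  define R where "R = K * (real N0 * (M + ?lam + dbar))"
  have "data p 1 \<in> V m p" by (rule data) simp
  then have "\<bar>snd (data p 1)\<bar> \<le> M" and "d0 - dbar \<le> ?lam"
    using p by (auto intro: M noise_bound_le_opt_cost)
  then have "0 \<le> M + ?lam + dbar"
    using d0_nonneg abs_ge_zero[of "snd (data p 1)"] by linarith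
  then have "0 \<le> R" using \<open>K > 0\<close> by (simp add: R_def)
  define D where "D = 1 + ?L * R"
  define \<beta> where "\<beta> = \<eta> / (2 * D)"
  have "0 < D" using \<open>0 \<le> R\<close> by (simp add: D_def add_pos_nonneg)
  then have "\<beta> > 0" and \<beta>_D: "\<beta> * D = \<eta> / 2"
    using \<open>0 < \<eta>\<close> by (simp_all add: \<beta>_def)
  obtain Nb where "\<forall>v\<in>V m p. \<exists>i\<in>{1..Nb}. vdist (data p i) v \<le> \<beta>"
    using informative[OF \<open>\<beta> > 0\<close>] by blast
  then have dense: "\<exists>i\<in>{1..max N0 Nb}. vdist (data p i) v \<le> \<beta>" if "v \<in> V m p" for v
    using that by fastforce
  have "?lam - \<eta> \<le> lambda_low dbar m data p (max N0 Nb)"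
  proof (rule lambda_low_greatest)
    fix lam \<theta> assume \<theta>: "length \<theta> = ?L"
      and fit: "\<And>i. i \<in> {1..max N0 Nb} \<Longrightarrow> \<bar>snd (data p i) - ip (fst (data p i)) \<theta>\<bar> \<le> lam + dbar"
    show "?lam - \<eta> \<le> lam"
    proof (cases "lam < ?lam")
      case True
      have "\<bar>ip (fst (data p i)) \<theta>\<bar> \<le> M + ?lam + dbar" if "i \<in> {1..N0}" for i
      proof -
        have "\<bar>ip (fst (data p i)) \<theta>\<bar> \<le> \<bar>snd (data p i)\<bar> + \<bar>snd (data p i) - ip (fst (data p i)) \<theta>\<bar>"
          using abs_triangle_ineq4[of "snd (data p i)" "snd (data p i) - ip (fst (data p i)) \<theta>"]
          by simp
        moreover have "\<bar>snd (data p i)\<bar> \<le> M" using that by (intro M data) simp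
        moreover have "i \<in> {1..max N0 Nb}" using that by auto
        ultimately show ?thesis using fit True by fastforce
      qed
      then obtain \<theta>' where \<theta>': "length \<theta>' = ?L"
        "\<forall>i\<ge>1. ip (fst (data p i)) \<theta>' = ip (fst (data p i)) \<theta>" "\<forall>j<?L. \<bar>\<theta>' ! j\<bar> \<le> R"
        using refit[OF \<theta>] unfolding R_def by blast
      have fit': "\<bar>snd (data p i) - ip (fst (data p i)) \<theta>'\<bar> \<le> lam + dbar"
        if "i \<in> {1..max N0 Nb}" for i
        using fit[OF that] \<theta>'(2) that by simp
      have "?lam \<le> lam + \<beta> * D"
        unfolding D_def using \<theta>'(3)
        by (intro opt_cost_le_fit_of_dense_samples[where data = data and p = p and m = m,
              OF p data dense fit' \<theta>'(1)]) auto
      then show ?thesis using \<beta>_D \<open>0 < \<eta>\<close> by linarith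
    qed (use \<open>0 < \<eta>\<close> in simp)
  qed
  then show ?thesis by blast
qed

end

theorem theorem1:
  fixes A :: "real^'n^'n" and B C :: "real^'n"
    and U :: "real set" and d0 dbar :: real and m :: nat
    and \<Omega> :: "nat \<Rightarrow> real list set"
    and data :: "nat \<Rightarrow> nat \<Rightarrow> real list \<times> real"
  assumes stable: "asympt_stable A"
    and obs: "completely_observable A C"
    and reach: "reachable A B"
    and U_compact: "compact U" and U_ne: "U \<noteq> {}"
    and d0_nonneg: "0 \<le> d0"
    and dbar_nonneg: "0 \<le> dbar"
    and order: "m \<ge> CARD('n)"
    and Omega_dim: "\<And>p \<theta>. \<theta> \<in> \<Omega> p \<Longrightarrow> length \<theta> = 2 * m + p - 1"
    and Omega_compact: "\<And>p. compact (list_emb ` \<Omega> p)"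
    and Omega_whole: "\<And>p. p \<ge> 1 \<Longrightarrow>
          (INF \<theta>\<in>\<Omega> p. cost (V_set A B C U d0 m p) dbar \<theta>)
        = (INF \<theta>\<in>{\<theta>. length \<theta> = 2 * m + p - 1}. cost (V_set A B C U d0 m p) dbar \<theta>)"
    and data_in_V: "\<And>p i. p \<ge> 1 \<Longrightarrow> i \<ge> 1 \<Longrightarrow> data p i \<in> V_set A B C U d0 m p"
    and informative: "\<And>p \<beta>. p \<ge> 1 \<Longrightarrow> \<beta> > 0 \<Longrightarrow>
          \<exists>N. \<forall>v\<in>V_set A B C U d0 m p. \<exists>i\<in>{1..N}. vdist (data p i) v \<le> \<beta>"
  shows "((\<lambda>p. lambda_p A B C U d0 dbar m \<Omega> p) \<longlonglongrightarrow> d0 - dbar)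
       \<and> (\<forall>p N. p \<ge> 1 \<longrightarrow> 0 \<le> lambda_p A B C U d0 dbar m \<Omega> p \<longrightarrow>
           lambda_low dbar m data p N \<le> lambda_p A B C U d0 dbar m \<Omega> p)
       \<and> (\<forall>p \<eta>. p \<ge> 1 \<longrightarrow> 0 < \<eta> \<longrightarrow> \<eta> \<le> lambda_p A B C U d0 dbar m \<Omega> p \<longrightarrow>
           (\<exists>N. lambda_low dbar m data p N \<ge> lambda_p A B C U d0 dbar m \<Omega> p - \<eta>))"
proof -
  interpret stable_plant A B C U d0
    using stable U_compact d0_nonneg by unfold_locales
  have "m \<ge> 1"
    using order by (metis One_nat_def Suc_leI finite_UNIV_card_ge_0 finite order_trans)
  have V_ne: "V m p \<noteq> {}" if "p \<ge> 1" for p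
    using data_in_V[OF that, of 1] by auto
  have lambda_eq: "lambda_p A B C U d0 dbar m \<Omega> p = opt_cost m dbar p" if "p \<ge> 1" for p
    unfolding lambda_p_def opt_cost_def using Omega_whole[OF that] .
  have "(\<lambda>p. lambda_p A B C U d0 dbar m \<Omega> p) \<longlonglongrightarrow> d0 - dbar"
  proof (rule Lim_transform_eventually[OF opt_cost_tendsto[OF \<open>m \<ge> 1\<close> V_ne]])
    show "\<forall>\<^sub>F p in sequentially. opt_cost m dbar p = lambda_p A B C U d0 dbar m \<Omega> p"
      unfolding eventually_sequentially using lambda_eq by (intro exI[of _ 1]) auto
  qed
  moreover have "lambda_low dbar m data p N \<le> lambda_p A B C U d0 dbar m \<Omega> p"
    if "p \<ge> 1" "0 \<le> lambda_p A B C U d0 dbar m \<Omega> p" for p N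
    using lambda_low_le_opt_cost[OF V_ne[OF \<open>p \<ge> 1\<close>] \<open>p \<ge> 1\<close>] data_in_V that lambda_eq
    by simp
  moreover have "\<exists>N. lambda_p A B C U d0 dbar m \<Omega> p - \<eta> \<le> lambda_low dbar m data p N"
    if "p \<ge> 1" "0 < \<eta>" for p \<eta>
  proof -
    have "\<exists>N. opt_cost m dbar p - \<eta> \<le> lambda_low dbar m data p N"
      using opt_cost_le_lambda_low[where data = data and p = p and m = m and dbar = dbar]
        data_in_V informative that by blast
    then show ?thesis using lambda_eq[OF \<open>p \<ge> 1\<close>] by simp
  qed
  ultimately show ?thesis by blast
qed

end
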